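(* Let $\{\varphi_1,\ldots,\varphi_n\}$ be a system of contracting similitudes of $\mathbb{R}^2$ satisfying the open convex set condition, let $K$ be its compact invariant self-similar set, and let $\tilde K$ be the convex hull of $K$. Then the set $F$ of vertices (extreme points) of $\tilde K$ has Hausdorff dimension $0$.
   Context: Identify $\mathbb{R}^2$ with $\mathbb{C}$. The contracting similitudes are $\varphi_i(z)=q_i e^{i\alpha_i}(z-z_i)+z_i$ (where the $i$ in $e^{i\alpha_i}$ is the imaginary unit), with $0<q_i<1$ and rotation angle $\alpha_i\in[0,2\pi]$. The invariant set $K$ is the unique non-empty compact set with $K=\bigcup_{i=1}^n\varphi_i(K)$. $\tilde K=H(K)$ is its convex hull. $F$ denotes the set of all extreme points of $\tilde K$, called the vertices of $\tilde K$. Open convex set condition (OCSC): there is a non-empty open convex set $O\subset\mathbb{R}^2$ such that $\bigcup_{i}\varphi_i(O)\subset O$ and $\varphi_i(O)\cap\varphi_j(O)=\emptyset$ whenever $i\neq j$. *)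

theory Defs
  imports "HOL-Analysis.Analysis"
begin

definition similitude :: "real \<Rightarrow> real \<Rightarrow> complex \<Rightarrow> complex \<Rightarrow> complex" where
  "similitude q \<alpha> c z = of_real q * exp (\<i> * of_real \<alpha>) * (z - c) + c"

definition invariant_set :: "'i set \<Rightarrow> ('i \<Rightarrow> 'a::topological_space \<Rightarrow> 'a) \<Rightarrow> 'a set \<Rightarrow> bool" where
  "invariant_set I \<phi> K \<longleftrightarrow> K \<noteq> {} \<and> compact K \<and> K = (\<Union>i\<in>I. \<phi> i ` K)"

definition open_convex_set_condition ::
    "'i set \<Rightarrow> ('i \<Rightarrow> 'a::real_normed_vector \<Rightarrow> 'a) \<Rightarrow> bool" where
  "open_convex_set_condition I \<phi> \<longleftrightarrow>
     (\<exists>S. S \<noteq> {} \<and> open S \<and> convex S \<and> (\<Union>i\<in>I. \<phi> i ` S) \<subseteq> S \<and>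
       (\<forall>i\<in>I. \<forall>j\<in>I. i \<noteq> j \<longrightarrow> \<phi> i ` S \<inter> \<phi> j ` S = {}))"

(* diam(U)^s with the conventions 0^0 = 1 for non-empty U, and 0 for empty U.  Plain powr would give
   0 powr 0 = 0, so that the 0-dimensional measure would not be counting measure. *)
definition diam_power :: "real \<Rightarrow> 'a::metric_space set \<Rightarrow> ennreal" where
  "diam_power s U =
     (if U = {} then 0 else if s = 0 then 1 else ennreal (diameter U powr s))"

(* Covers are sequences of sets; finite covers are included since members may be empty.
   Boundedness is required explicitly because diameter is unspecified on unbounded sets. *)
definition hausdorff_premeasure :: "real \<Rightarrow> real \<Rightarrow> 'a::metric_space set \<Rightarrow> ennreal" where
  "hausdorff_premeasure s \<delta> A =
     (INF U \<in> {U :: nat \<Rightarrow> 'a set. A \<subseteq> (\<Union>i. U i) \<and> (\<forall>i. bounded (U i) \<and> diameter (U i) \<le> \<delta>)}.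
        \<Sum>i. diam_power s (U i))"

definition hausdorff_measure :: "real \<Rightarrow> 'a::metric_space set \<Rightarrow> ennreal" where
  "hausdorff_measure s A = (SUP \<delta>\<in>{0<..}. hausdorff_premeasure s \<delta> A)"

(* Valued in ennreal so that the infimum over no exponents is infinity. *)
definition hausdorff_dim :: "'a::metric_space set \<Rightarrow> ennreal" where
  "hausdorff_dim A = (INF s\<in>{s. 0 \<le> s \<and> hausdorff_measure s A = 0}. ennreal s)"

end

theory Submission
  imports Defs
begin

text \<open>
  The vertices are found in those pieces of \<open>K\<close> that reach furthest in some direction, and the
  point is that there are few of them. Give each direction \<open>\<theta>\<close> the index \<open>c \<theta>\<close> of a piece
  \<open>\<phi>\<^sub>i K\<close> on which the functional \<open>x \<mapsto> x \<bullet> cis \<theta>\<close> attains its maximum over \<open>K\<close>. As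
  \<open>\<phi>\<^sub>i\<close> rotates by \<open>\<alpha>\<^sub>i\<close>, the part of that piece on which the maximum is attained is the image
  of the part of \<open>K\<close> that is extremal in direction \<open>\<theta> - \<alpha>\<^sub>i\<close>. Following the circle map
  \<open>\<theta> \<mapsto> \<theta> - \<alpha> (c \<theta>)\<close> for \<open>m\<close> steps therefore produces a word \<open>w\<close> of length \<open>m\<close> such that
  \<open>\<phi>\<^sub>w K\<close> meets the face of \<open>K\<close> in direction \<open>\<theta>\<close> (\<open>itinerary_piece_dominates\<close>). The union
  \<open>X\<close> of the pieces \<open>\<phi>\<^sub>w K\<close> over all these words is a compact subset of \<open>K\<close> with the same
  support function, so it has the same convex hull and contains every vertex
  (\<open>extreme_points_in_dominating_subset\<close>).

  The open convex set condition enters through the shape of \<open>c\<close>. The closure of the open convex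
  set contains \<open>K\<close>, and disjoint convex sets are separated by a line, so any two pieces of \<open>K\<close>
  are separated by a line (\<open>open_convex_set_condition_pieces_separated\<close>). While \<open>\<theta>\<close> runs
  through a half turn that starts at a normal of this line, the comparison of the two pieces
  changes at most once (\<open>dominates_mono_half_turn\<close>). Hence \<open>c\<close> is piecewise constant and the
  circle map is a piecewise rotation with finitely many pieces.

  Piecewise rotations have zero entropy. For fixed \<open>N\<close> the word of the first \<open>N\<close> steps is
  again piecewise constant, so it takes at most three values on each interval shorter than some
  \<open>e\<close>: one to the left of a breakpoint, one at it and one to the right. On each of
  the three parts the \<open>N\<close>th iterate is a translation, so the part stays shorter than \<open>e\<close> and
  the estimate can be repeated: there are at most \<open>M * 3 ^ k\<close> words of length \<open>k * N\<close>
  (\<open>itinerary_growth\<close>). If all ratios are at most \<open>r < 1\<close>, the corresponding pieces have diameter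
  at most a constant times \<open>r ^ (k * N)\<close>. For given \<open>s > 0\<close>, choose \<open>N\<close> with
  \<open>3 * r powr (N * s) < 1\<close>; then the \<open>s\<close>-dimensional sums of these covers tend to zero as
  \<open>k\<close> grows (\<open>hausdorff_measure_zero_of_exponential_covers\<close>).
\<close>

section \<open>Piecewise constant codings of the line\<close>

text \<open>Only one-sided germs are prescribed, so the value at a breakpoint is free; by compactness a
  bounded interval then contains finitely many breakpoints. In this form the property
  passes to compositions with piecewise translations.\<close>

definition piecewise_const :: "(real \<Rightarrow> 'a) \<Rightarrow> bool" where
  "piecewise_const f \<longleftrightarrow>
     (\<forall>x. (\<exists>a. \<forall>\<^sub>F y in at_left x. f y = a) \<and> (\<exists>a. \<forall>\<^sub>F y in at_right x. f y = a))"

lemma eventually_const_finite_family: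
  assumes "finite I" "\<And>i. i \<in> I \<Longrightarrow> \<exists>a. \<forall>\<^sub>F y in F. f i y = a"
  shows "\<exists>a. \<forall>\<^sub>F y in F. \<forall>i\<in>I. f i y = a i"
proof -
  obtain a where "\<And>i. i \<in> I \<Longrightarrow> \<forall>\<^sub>F y in F. f i y = a i"
    using assms(2) by metis
  then show ?thesis using assms(1) by (auto simp: eventually_ball_finite_distrib)
qed

text \<open>The hypothesis on \<^term>\<open>g\<close> says that it factors through the tuple of the finitely many
  \<^term>\<open>f i\<close>, all of which are constant on a common one-sided neighbourhood.\<close>

lemma piecewise_const_determined:
  assumes fin: "finite I" and pc: "\<And>i. i \<in> I \<Longrightarrow> piecewise_const (f i)"
    and det: "\<And>y z. (\<And>i. i \<in> I \<Longrightarrow> f i y = f i z) \<Longrightarrow> g y = g z"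
  shows "piecewise_const g"
proof -
  have *: "\<exists>b. \<forall>\<^sub>F y in F. g y = b"
    if ne: "F \<noteq> bot" and ev: "\<And>i. i \<in> I \<Longrightarrow> \<exists>a. \<forall>\<^sub>F y in F. f i y = a" for F
  proof -
    obtain a where a: "\<forall>\<^sub>F y in F. \<forall>i\<in>I. f i y = a i"
      using eventually_const_finite_family[OF fin, of f F] ev by blast
    obtain y0 where y0: "\<forall>i\<in>I. f i y0 = a i"
      using eventually_happens[OF a] ne by auto
    have "\<forall>\<^sub>F y in F. g y = g y0"
      using a by eventually_elim (use y0 in \<open>intro det, simp\<close>)
    then show ?thesis by blast
  qed
  show ?thesis
    unfolding piecewise_const_def
    using pc by (intro allI conjI *) (auto simp: piecewise_const_def)
qed

text \<open>A monotone predicate switches at most once, so near \<^term>\<open>x\<close> the switch is over or has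
  not happened.\<close>

lemma mono_pred_eventually_const_at_left:
  fixes P :: "real \<Rightarrow> bool"
  assumes "l < x"
    and "(\<forall>s t. l < s \<and> s < t \<and> t < x \<and> P s \<longrightarrow> P t) \<or> (\<forall>s t. l < s \<and> s < t \<and> t < x \<and> P t \<longrightarrow> P s)"
  shows "\<exists>b. \<forall>\<^sub>F y in at_left x. P y = b"
  using assms(2)
proof
  assume up: "\<forall>s t. l < s \<and> s < t \<and> t < x \<and> P s \<longrightarrow> P t"
  show ?thesis
  proof (cases "\<exists>s. l < s \<and> s < x \<and> P s")
    case True
    then obtain s where s: "l < s" "s < x" "P s" by blast
    then have "\<forall>\<^sub>F y in at_left x. P y = True"
      using up by (auto simp: eventually_at_left_field intro!: exI[of _ s])
    then show ?thesis by blast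
  next
    case False
    then have "\<forall>\<^sub>F y in at_left x. P y = False"
      using assms(1) by (auto simp: eventually_at_left_field intro!: exI[of _ l])
    then show ?thesis by blast
  qed
next
  assume down: "\<forall>s t. l < s \<and> s < t \<and> t < x \<and> P t \<longrightarrow> P s"
  show ?thesis
  proof (cases "\<exists>s. l < s \<and> s < x \<and> \<not> P s")
    case True
    then obtain s where s: "l < s" "s < x" "\<not> P s" by blast
    then have "\<forall>y>s. y < x \<longrightarrow> P y = False" using down by blast
    then have "\<forall>\<^sub>F y in at_left x. P y = False"
      using s(2) unfolding eventually_at_left_field by blast
    then show ?thesis by blast
  next
    case False
    then have "\<forall>\<^sub>F y in at_left x. P y = True"
      using assms(1) by (auto simp: eventually_at_left_field intro!: exI[of _ l])
    then show ?thesis by blast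
  qed
qed

lemma mono_pred_eventually_const_at_right:
  fixes P :: "real \<Rightarrow> bool"
  assumes "x < r"
    and "(\<forall>s t. x < s \<and> s < t \<and> t < r \<and> P s \<longrightarrow> P t) \<or> (\<forall>s t. x < s \<and> s < t \<and> t < r \<and> P t \<longrightarrow> P s)"
  shows "\<exists>b. \<forall>\<^sub>F y in at_right x. P y = b"
proof -
  have "(\<forall>s t. - r < s \<and> s < t \<and> t < - x \<and> P (- s) \<longrightarrow> P (- t)) \<or>
        (\<forall>s t. - r < s \<and> s < t \<and> t < - x \<and> P (- t) \<longrightarrow> P (- s))"
    using assms(2)
  proof
    assume up: "\<forall>s t. x < s \<and> s < t \<and> t < r \<and> P s \<longrightarrow> P t"
    have "P (- s)" if "- r < s" "s < t" "t < - x" "P (- t)" for s t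
      using up[rule_format, of "- t" "- s"] that by auto
    then show ?thesis by blast
  next
    assume down: "\<forall>s t. x < s \<and> s < t \<and> t < r \<and> P t \<longrightarrow> P s"
    have "P (- t)" if "- r < s" "s < t" "t < - x" "P (- s)" for s t
      using down[rule_format, of "- t" "- s"] that by auto
    then show ?thesis by blast
  qed
  then have "\<exists>b. \<forall>\<^sub>F y in at_left (- x). P (- y) = b"
    using assms(1) by (intro mono_pred_eventually_const_at_left[of "- r"]) auto
  then show ?thesis
    by (simp add: at_right_minus[of x] eventually_filtermap)
qed

section \<open>Counting itineraries\<close>

text \<open>Symbolic orbit of the map that moves \<^term>\<open>\<theta>\<close> back by the amount attached to its symbol. The
  state is an angle in the line and not on the circle: every iterate is then locally a plain
  translation, and the circle appears only as periodicity of \<^term>\<open>c\<close>.\<close>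

fun itinerary :: "(real \<Rightarrow> 'a) \<Rightarrow> ('a \<Rightarrow> real) \<Rightarrow> nat \<Rightarrow> real \<Rightarrow> 'a list" where
  "itinerary c \<alpha> 0 \<theta> = []"
| "itinerary c \<alpha> (Suc m) \<theta> = c \<theta> # itinerary c \<alpha> m (\<theta> - \<alpha> (c \<theta>))"

lemma length_itinerary [simp]: "length (itinerary c \<alpha> m \<theta>) = m"
  by (induction m arbitrary: \<theta>) auto

lemma set_itinerary_subset: "range c \<subseteq> I \<Longrightarrow> set (itinerary c \<alpha> m \<theta>) \<subseteq> I"
  by (induction m arbitrary: \<theta>) auto

text \<open>The position after \<^term>\<open>m\<close> steps depends on the word read so far only up to a
  translation; this makes the counting below repeatable.\<close>

lemma itinerary_add:
  "itinerary c \<alpha> (m + k) \<theta> =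
     itinerary c \<alpha> m \<theta> @ itinerary c \<alpha> k (\<theta> - sum_list (map \<alpha> (itinerary c \<alpha> m \<theta>)))"
  by (induction m arbitrary: \<theta>) (auto simp: algebra_simps)

lemma itinerary_periodic:
  assumes "\<And>\<theta>. c (\<theta> + p) = c \<theta>"
  shows "itinerary c \<alpha> m (\<theta> + p) = itinerary c \<alpha> m \<theta>"
proof (induction m arbitrary: \<theta>)
  case (Suc m)
  show ?case using Suc[of "\<theta> - \<alpha> (c \<theta>)"] by (simp add: assms algebra_simps)
qed auto

lemma filterlim_shift_at_left: "filterlim (\<lambda>y. y - d) (at_left (x - d)) (at_left (x::real))"
  by (auto simp: filterlim_at intro!: tendsto_intros eventually_at_leftI[of "x - 1"])

lemma filterlim_shift_at_right: "filterlim (\<lambda>y. y - d) (at_right (x - d)) (at_right (x::real))"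
  by (auto simp: filterlim_at intro!: tendsto_intros eventually_at_rightI[of _ "x + 1"])

lemma piecewise_const_itinerary:
  assumes c: "piecewise_const c"
  shows "piecewise_const (itinerary c \<alpha> m)"
proof (induction m)
  case 0
  show ?case by (simp add: piecewise_const_def)
next
  case (Suc m)
  have *: "\<exists>w. \<forall>\<^sub>F y in F x. itinerary c \<alpha> (Suc m) y = w"
    if lim: "\<And>d. filterlim (\<lambda>y. y - d) (F (x - d)) (F x)"
      and c': "\<exists>a. \<forall>\<^sub>F y in F x. c y = a"
      and it: "\<And>x. \<exists>w. \<forall>\<^sub>F y in F x. itinerary c \<alpha> m y = w" for F and x :: real
  proof -
    obtain a where a: "\<forall>\<^sub>F y in F x. c y = a" using c' by blast
    obtain w where w: "\<forall>\<^sub>F y in F (x - \<alpha> a). itinerary c \<alpha> m y = w" using it by blast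
    have "\<forall>\<^sub>F y in F x. itinerary c \<alpha> m (y - \<alpha> a) = w"
      using lim[of "\<alpha> a"] w unfolding filterlim_iff by blast
    then have "\<forall>\<^sub>F y in F x. itinerary c \<alpha> (Suc m) y = a # w"
      using a by eventually_elim simp
    then show ?thesis by blast
  qed
  show ?case
    unfolding piecewise_const_def
    using c Suc
    by (intro allI conjI *[where F = at_left] *[where F = at_right]
         filterlim_shift_at_left filterlim_shift_at_right) (auto simp: piecewise_const_def)
qed

lemma periodic_of_int:
  fixes f :: "real \<Rightarrow> 'a"
  assumes "\<And>\<theta>. f (\<theta> + p) = f \<theta>"
  shows "f (\<theta> + of_int k * p) = f \<theta>"
proof (induction k rule: int_induct[where k = 0])
  case (step1 i)
  have "f (\<theta> + of_int (i + 1) * p) = f ((\<theta> + of_int i * p) + p)" by (simp add: algebra_simps)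
  then show ?case using assms step1 by metis
next
  case (step2 i)
  have "f (\<theta> + of_int i * p) = f ((\<theta> + of_int (i - 1) * p) + p)" by (simp add: algebra_simps)
  then show ?case using assms step2 by metis
qed auto

lemma obtain_shift_into_period:
  fixes p y :: real
  assumes "p > 0"
  obtains k :: int where "y + of_int k * p \<in> {0..p}"
proof
  have "of_int \<lfloor>y / p\<rfloor> * p \<le> y / p * p"
    using assms by (intro mult_right_mono) auto
  moreover have "y / p * p < (of_int \<lfloor>y / p\<rfloor> + 1) * p"
    using assms floor_correct[of "y / p"] by (intro mult_strict_right_mono) auto
  ultimately have "of_int \<lfloor>y / p\<rfloor> * p \<le> y" "y < (of_int \<lfloor>y / p\<rfloor> + 1) * p"
    using assms by auto
  then show "y + of_int (- \<lfloor>y / p\<rfloor>) * p \<in> {0..p}" by (auto simp: algebra_simps)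
qed

text \<open>The number \<^term>\<open>e\<close> is a Lebesgue number, on one period, for the cover by neighbourhoods
  with at most one breakpoint, namely their centre. Periodicity carries it to the whole line.\<close>

lemma periodic_piecewise_const_uniform:
  assumes f: "piecewise_const f" and p: "p > 0" and per: "\<And>\<theta>. f (\<theta> + p) = f \<theta>"
  obtains e where "e > 0"
    "\<And>y. \<exists>x a b. \<forall>z\<in>ball y e. (z < x \<longrightarrow> f z = a) \<and> (x < z \<longrightarrow> f z = b)"
proof -
  have "\<exists>d a b. d > 0 \<and> (\<forall>z\<in>ball x d. (z < x \<longrightarrow> f z = a) \<and> (x < z \<longrightarrow> f z = b))" for x
  proof -
    obtain a b where a: "\<forall>\<^sub>F y in at_left x. f y = a" and b: "\<forall>\<^sub>F y in at_right x. f y = b"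
      using f unfolding piecewise_const_def by blast
    obtain l r where l: "l < x" "\<forall>y>l. y < x \<longrightarrow> f y = a" and r: "r > x" "\<forall>y>x. y < r \<longrightarrow> f y = b"
      using a b by (auto simp: eventually_at_left_field eventually_at_right_field)
    show ?thesis
      using l r by (intro exI[of _ "min (x - l) (r - x)"] exI[of _ a] exI[of _ b])
        (auto simp: dist_real_def)
  qed
  then obtain d a b where d: "\<And>x. d x > 0"
    and ab: "\<And>x z. z \<in> ball x (d x) \<Longrightarrow> (z < x \<longrightarrow> f z = a x) \<and> (x < z \<longrightarrow> f z = b x)"
    by metis
  have "{0..p} \<subseteq> (\<Union>x. ball x (d x))" using d centre_in_ball by blast
  then obtain e where e: "e > 0" "\<And>y. y \<in> {0..p} \<Longrightarrow> \<exists>G\<in>range (\<lambda>x. ball x (d x)). ball y e \<subseteq> G"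
    by (rule Heine_Borel_lemma[OF compact_Icc]) auto
  show thesis
  proof
    fix y :: real
    obtain k :: int where k: "y + of_int k * p \<in> {0..p}"
      using obtain_shift_into_period[OF p] by metis
    obtain x where x: "ball (y + of_int k * p) e \<subseteq> ball x (d x)"
      using e(2)[OF k] by blast
    have "(z < x - of_int k * p \<longrightarrow> f z = a x) \<and> (x - of_int k * p < z \<longrightarrow> f z = b x)"
      if "z \<in> ball y e" for z
    proof -
      have "z + of_int k * p \<in> ball (y + of_int k * p) e" using that by (simp add: dist_real_def)
      then have "z + of_int k * p \<in> ball x (d x)" using x by blast
      from ab[OF this] show ?thesis
        using periodic_of_int[of f p z k, OF per] by auto
    qed
    then show "\<exists>x a b. \<forall>z\<in>ball y e. (z < x \<longrightarrow> f z = a) \<and> (x < z \<longrightarrow> f z = b)" by blast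
  qed (fact e(1))
qed

lemma card_Un_le_add:
  assumes "finite A" "finite B" "card A \<le> a" "card B \<le> b"
  shows "finite (A \<union> B) \<and> card (A \<union> B) \<le> a + b"
  using card_Un_le[of A B] assms by auto

text \<open>Each block of \<^term>\<open>N\<close> steps cuts a short set into at most three parts and translates each
  part rigidly, hence into another short ball, where the induction hypothesis applies.\<close>

lemma itinerary_local_growth:
  assumes split: "\<And>y. \<exists>x a b. \<forall>z\<in>ball y e. (z < x \<longrightarrow> itinerary c \<alpha> N z = a) \<and> (x < z \<longrightarrow> itinerary c \<alpha> N z = b)"
    and "J \<subseteq> ball y e"
  shows "finite (itinerary c \<alpha> (k * N) ` J) \<and> card (itinerary c \<alpha> (k * N) ` J) \<le> 3 ^ k"
  using assms(2)
proof (induction k arbitrary: J y)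
  case 0
  have "itinerary c \<alpha> 0 ` J \<subseteq> {[]}" by auto
  then show ?case
    using card_mono[of "{[]}" "itinerary c \<alpha> 0 ` J"] by (auto intro: finite_subset)
next
  case (Suc k)
  let ?I = "itinerary c \<alpha> (Suc k * N)"
  obtain x a b where
    xab: "\<forall>z\<in>ball y e. (z < x \<longrightarrow> itinerary c \<alpha> N z = a) \<and> (x < z \<longrightarrow> itinerary c \<alpha> N z = b)"
    using split[of y] by (elim exE)
  have piece: "finite (?I ` P) \<and> card (?I ` P) \<le> 3 ^ k"
    if P: "P \<subseteq> J" and w: "\<And>z. z \<in> P \<Longrightarrow> itinerary c \<alpha> N z = w" for P w
  proof -
    define d where "d = sum_list (map \<alpha> w)"
    have "?I z = w @ itinerary c \<alpha> (k * N) (z - d)" if "z \<in> P" for z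
      using itinerary_add[of c \<alpha> N "k * N" z] w[OF that] by (simp add: d_def)
    then have eq: "?I ` P = (@) w ` itinerary c \<alpha> (k * N) ` ((\<lambda>z. z - d) ` P)"
      by (auto simp: image_image)
    have "(\<lambda>z. z - d) ` P \<subseteq> ball (y - d) e"
      using P Suc.prems by (auto simp: dist_real_def)
    from Suc.IH[OF this] show ?thesis
      unfolding eq by (meson card_image_le finite_imageI le_trans)
  qed
  have "J = J \<inter> {..<x} \<union> J \<inter> {x} \<union> J \<inter> {x<..}" by auto
  then have "?I ` J = ?I ` (J \<inter> {..<x}) \<union> ?I ` (J \<inter> {x}) \<union> ?I ` (J \<inter> {x<..})" by blast
  moreover have "finite (?I ` (J \<inter> {..<x})) \<and> card (?I ` (J \<inter> {..<x})) \<le> 3 ^ k"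
    using Suc.prems by (intro piece[of _ a] xab[rule_format, THEN conjunct1, rule_format]) auto
  moreover have "finite (?I ` (J \<inter> {x})) \<and> card (?I ` (J \<inter> {x})) \<le> 3 ^ k"
    by (intro piece[of _ "itinerary c \<alpha> N x"]) auto
  moreover have "finite (?I ` (J \<inter> {x<..})) \<and> card (?I ` (J \<inter> {x<..})) \<le> 3 ^ k"
    using Suc.prems by (intro piece[of _ b] xab[rule_format, THEN conjunct2, rule_format]) auto
  ultimately show ?case
    using card_Un_le_add[of "?I ` (J \<inter> {..<x}) \<union> ?I ` (J \<inter> {x})" "?I ` (J \<inter> {x<..})" "2 * 3 ^ k" "3 ^ k"]
      card_Un_le_add[of "?I ` (J \<inter> {..<x})" "?I ` (J \<inter> {x})" "3 ^ k" "3 ^ k"]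
    by simp
qed

text \<open>Zero entropy of piecewise translations: the growth rate is at most the \<^term>\<open>N\<close>th
  root of 3, where \<^term>\<open>N\<close> is arbitrary while \<^term>\<open>M\<close> depends on it.\<close>

theorem itinerary_growth:
  assumes c: "piecewise_const c" and p: "p > 0" and per: "\<And>\<theta>. c (\<theta> + p) = c \<theta>"
  obtains M where "\<And>k. finite (range (itinerary c \<alpha> (k * N)))"
    "\<And>k. card (range (itinerary c \<alpha> (k * N))) \<le> M * 3 ^ k"
proof -
  obtain e where e: "e > 0" and split:
    "\<And>y. \<exists>x a b. \<forall>z\<in>ball y e. (z < x \<longrightarrow> itinerary c \<alpha> N z = a) \<and> (x < z \<longrightarrow> itinerary c \<alpha> N z = b)"
    using periodic_piecewise_const_uniform[OF piecewise_const_itinerary[OF c] p itinerary_periodic[of c p, OF per]]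
    by blast
  obtain Y where Y: "finite Y" "{0..p} \<subseteq> (\<Union>y\<in>Y. ball y e)"
    using compact_Icc[of 0 p] e unfolding compact_eq_totally_bounded by metis
  have cover: "range (itinerary c \<alpha> m) = (\<Union>y\<in>Y. itinerary c \<alpha> m ` (ball y e))" for m
  proof -
    have "itinerary c \<alpha> m \<theta> \<in> (\<Union>y\<in>Y. itinerary c \<alpha> m ` (ball y e))" for \<theta>
    proof -
      obtain k :: int where k: "\<theta> + of_int k * p \<in> {0..p}"
        using obtain_shift_into_period[OF p] by metis
      have "itinerary c \<alpha> m \<theta> = itinerary c \<alpha> m (\<theta> + of_int k * p)"
        using periodic_of_int[of "itinerary c \<alpha> m" p \<theta> k, OF itinerary_periodic[of c p, OF per]] by simp
      then show ?thesis using k Y(2) by blast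
    qed
    then show ?thesis by auto
  qed
  show thesis
  proof
    fix k
    note loc = itinerary_local_growth[OF split, of _ _ k, OF subset_refl]
    show "finite (range (itinerary c \<alpha> (k * N)))"
      unfolding cover using Y(1) loc by blast
    have "card (range (itinerary c \<alpha> (k * N))) \<le> (\<Sum>y\<in>Y. card (itinerary c \<alpha> (k * N) ` ball y e))"
      unfolding cover by (rule card_UN_le[OF Y(1)])
    also have "\<dots> \<le> card Y * 3 ^ k"
      using sum_bounded_above[of Y "\<lambda>y. card (itinerary c \<alpha> (k * N) ` ball y e)" "3 ^ k"] loc by simp
    finally show "card (range (itinerary c \<alpha> (k * N))) \<le> card Y * 3 ^ k" .
  qed
qed

section \<open>Which of two separated sets reaches further in a given direction\<close>

text \<open>For compact sets this compares the values of the support functions at \<^term>\<open>v\<close>. The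
  form with quantifiers needs no suprema.\<close>

definition dominates :: "'a::real_inner \<Rightarrow> 'a set \<Rightarrow> 'a set \<Rightarrow> bool" where
  "dominates v A B \<longleftrightarrow> (\<forall>y\<in>B. \<exists>x\<in>A. y \<bullet> v \<le> x \<bullet> v)"

text \<open>Turning towards a direction in which all of \<^term>\<open>A\<close> lies beyond all of \<^term>\<open>B\<close> can only
  help \<^term>\<open>A\<close>.\<close>

lemma dominates_towards:
  assumes "dominates v A B" "\<And>x y. x \<in> A \<Longrightarrow> y \<in> B \<Longrightarrow> y \<bullet> p \<le> x \<bullet> p" "0 \<le> a" "0 \<le> b"
  shows "dominates (a *\<^sub>R v + b *\<^sub>R p) A B"
  unfolding dominates_def
proof
  fix y assume y: "y \<in> B"
  then obtain x where x: "x \<in> A" "y \<bullet> v \<le> x \<bullet> v" using assms(1) unfolding dominates_def by blast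
  have "a * (y \<bullet> v) + b * (y \<bullet> p) \<le> a * (x \<bullet> v) + b * (x \<bullet> p)"
    using x y assms by (intro add_mono mult_left_mono) auto
  then show "\<exists>x\<in>A. y \<bullet> (a *\<^sub>R v + b *\<^sub>R p) \<le> x \<bullet> (a *\<^sub>R v + b *\<^sub>R p)"
    using x(1) by (auto simp: inner_add_right)
qed

lemma dominates_mono: "dominates v A B \<Longrightarrow> A \<subseteq> A' \<Longrightarrow> dominates v A' B"
  unfolding dominates_def by blast

text \<open>The sine rule: the coefficients of a unit vector with respect to two others are quotients of
  sines of the enclosed angles.\<close>

lemma cis_between:
  assumes "g < s" "s < t" "t < g + pi"
  obtains a b where "a > 0" "b > 0" "cis s = a *\<^sub>R cis t + b *\<^sub>R cis g"
proof
  have pos: "sin (t - g) > 0" "sin (s - g) > 0" "sin (t - s) > 0"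
    using assms by (auto intro!: sin_gt_zero)
  then show "sin (s - g) / sin (t - g) > 0" "sin (t - s) / sin (t - g) > 0" by auto
  have "sin (t - g) * cos s = sin (s - g) * cos t + sin (t - s) * cos g"
       "sin (t - g) * sin s = sin (s - g) * sin t + sin (t - s) * sin g"
    by (simp_all add: sin_diff algebra_simps)
  then show "cis s = (sin (s - g) / sin (t - g)) *\<^sub>R cis t + (sin (t - s) / sin (t - g)) *\<^sub>R cis g"
    using pos by (simp add: complex_eq_iff field_simps)
qed

text \<open>The direction turns from one normal of a separating line to the opposite one. At the
  first, one set lies beyond the other, and at the second the order is reversed. As the direction
  moves away from the normal that favours \<^term>\<open>A\<close> the lead of \<^term>\<open>A\<close> can only be lost, and
  as it moves towards that normal the lead can only be gained.\<close>

lemma dominates_mono_half_turn: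
  assumes "(\<forall>x\<in>A. \<forall>y\<in>B. y \<bullet> cis g \<le> x \<bullet> cis g) \<or> (\<forall>x\<in>A. \<forall>y\<in>B. x \<bullet> cis g \<le> y \<bullet> cis g)"
  shows "(\<forall>s t. g < s \<and> s < t \<and> t < g + pi \<and> dominates (cis s) A B \<longrightarrow> dominates (cis t) A B) \<or>
         (\<forall>s t. g < s \<and> s < t \<and> t < g + pi \<and> dominates (cis t) A B \<longrightarrow> dominates (cis s) A B)"
  using assms
proof
  assume sep: "\<forall>x\<in>A. \<forall>y\<in>B. y \<bullet> cis g \<le> x \<bullet> cis g"
  have "dominates (cis s) A B" if st: "g < s" "s < t" "t < g + pi" and dom: "dominates (cis t) A B" for s t
  proof -
    obtain a b where ab: "a > 0" "b > 0" "cis s = a *\<^sub>R cis t + b *\<^sub>R cis g"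
      using cis_between[OF st] by blast
    show ?thesis unfolding ab(3) using sep ab(1,2) by (intro dominates_towards dom) auto
  qed
  then show ?thesis by blast
next
  assume sep: "\<forall>x\<in>A. \<forall>y\<in>B. x \<bullet> cis g \<le> y \<bullet> cis g"
  have "dominates (cis t) A B" if st: "g < s" "s < t" "t < g + pi" and dom: "dominates (cis s) A B" for s t
  proof -
    obtain a b where ab: "a > 0" "b > 0" "cis s = a *\<^sub>R cis t + b *\<^sub>R cis g"
      using cis_between[OF st] by blast
    then have eq: "cis t = (1 / a) *\<^sub>R cis s + (b / a) *\<^sub>R (- cis g)"
      by (simp add: scaleR_add_right)
    show ?thesis unfolding eq using sep ab(1,2) by (intro dominates_towards dom) auto
  qed
  then show ?thesis by blast
qed

text \<open>The angles \<^term>\<open>Arg a + of_int k * pi\<close> of the two normals of the separating line cut the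
  line of angles into half turns on each of which the comparison is monotone. A small one-sided
  neighbourhood of any angle lies in one of them.\<close>

lemma piecewise_const_dominates:
  assumes a: "a \<noteq> 0" and sep: "\<And>x y. x \<in> A \<Longrightarrow> y \<in> B \<Longrightarrow> x \<bullet> a \<le> y \<bullet> (a :: complex)"
  shows "piecewise_const (\<lambda>\<theta>. dominates (cis \<theta>) A B)"
  unfolding piecewise_const_def
proof (intro allI conjI)
  fix x :: real
  define g where "g k = Arg a + of_int k * pi" for k :: int
  have cis_g: "cis (g k) = cis (Arg a) \<or> cis (g k) = - cis (Arg a)" for k
  proof -
    have "cis (of_int k * pi) = 1 \<or> cis (of_int k * pi) = - 1"
      using cos_npi_int[of k] sin_npi_int[of k] by (auto simp: complex_eq_iff mult.commute)
    then show ?thesis by (auto simp: g_def simp flip: cis_mult)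
  qed
  have "x \<bullet> cis (Arg a) \<le> y \<bullet> cis (Arg a)" if "x \<in> A" "y \<in> B" for x y
  proof -
    have "cis (Arg a) = (1 / norm a) *\<^sub>R a" using a by (simp add: cis_Arg sgn_div_norm divide_inverse)
    then show ?thesis using sep[OF that] a by (simp add: divide_right_mono)
  qed
  then have sep_g: "(\<forall>x\<in>A. \<forall>y\<in>B. y \<bullet> cis (g k) \<le> x \<bullet> cis (g k)) \<or>
      (\<forall>x\<in>A. \<forall>y\<in>B. x \<bullet> cis (g k) \<le> y \<bullet> cis (g k))" for k
    using cis_g[of k] by auto
  note mono = dominates_mono_half_turn[OF sep_g]
  (* The half turn that contains a left neighbourhood of x; if x is itself one of the angles g, it
     is the half turn that ends at x, hence the ceiling. *)
  define k where "k = \<lceil>(x - Arg a) / pi\<rceil> - 1"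
  have "(x - Arg a) / pi \<le> of_int k + 1" "of_int k < (x - Arg a) / pi"
    using ceiling_correct[of "(x - Arg a) / pi"] by (auto simp: k_def)
  then have k: "g k < x" "x \<le> g k + pi"
    by (simp_all add: g_def pos_less_divide_eq pos_divide_le_eq distrib_right)
  show "\<exists>b. \<forall>\<^sub>F y in at_left x. dominates (cis y) A B = b"
    by (rule mono_pred_eventually_const_at_left[OF k(1)])
       (use mono[of k] k in \<open>meson less_le_trans\<close>)
  define l where "l = \<lfloor>(x - Arg a) / pi\<rfloor>"
  have "of_int l \<le> (x - Arg a) / pi" "(x - Arg a) / pi < of_int l + 1"
    using floor_correct[of "(x - Arg a) / pi"] by (auto simp: l_def)
  then have l: "g l \<le> x" "x < g l + pi"
    by (simp_all add: g_def pos_divide_less_eq pos_le_divide_eq distrib_right)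
  show "\<exists>b. \<forall>\<^sub>F y in at_right x. dominates (cis y) A B = b"
    by (rule mono_pred_eventually_const_at_right[OF l(2)])
       (use mono[of l] l in \<open>meson le_less_trans\<close>)
qed

section \<open>Sets that contain all extreme points\<close>

text \<open>A point of \<^term>\<open>K\<close> outside the hull of \<^term>\<open>X\<close> could be strictly separated from it, in
  a direction where \<^term>\<open>X\<close> would fail to dominate. So the hulls agree, and extreme points of the
  hull of a set belong to the set. This treats all vertices at once, including those that are not
  the unique maximum of any linear functional.\<close>

lemma extreme_points_in_dominating_subset:
  fixes X K :: "complex set"
  assumes "compact X" "X \<subseteq> K" "\<And>\<theta>. dominates (cis \<theta>) X K"
  shows "{x. x extreme_point_of (convex hull K)} \<subseteq> X"
proof -
  have "z \<in> convex hull X" if z: "z \<in> K" for z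
  proof (rule ccontr)
    assume "z \<notin> convex hull X"
    moreover have "closed (convex hull X)"
      using assms(1) by (simp add: compact_convex_hull compact_imp_closed)
    ultimately obtain a b where ab: "a \<bullet> z < b" "\<And>x. x \<in> convex hull X \<Longrightarrow> b < a \<bullet> x"
      using separating_hyperplane_closed_point[of "convex hull X" z] by (auto simp: convex_convex_hull)
    define v where "v = - a"
    have v: "v = norm v *\<^sub>R cis (Arg v)"
      by (metis rcis_cmod_Arg rcis_def scaleR_conv_of_real)
    obtain x where x: "x \<in> X" "z \<bullet> cis (Arg v) \<le> x \<bullet> cis (Arg v)"
      using assms(3) z unfolding dominates_def by blast
    have "z \<bullet> v \<le> x \<bullet> v"
      by (subst (1 2) v) (use x in \<open>simp add: mult_left_mono\<close>)
    moreover have "b < a \<bullet> x" using ab(2) x(1) hull_inc by metis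
    ultimately show False using ab(1) by (simp add: v_def inner_commute)
  qed
  then have "convex hull K = convex hull X"
    using assms(2) by (metis convex_convex_hull hull_minimal hull_mono subsetI subset_antisym)
  then show ?thesis using extreme_point_of_convex_hull by auto
qed

section \<open>Iterated similitudes\<close>

text \<open>The adjoint of a rotation is the inverse rotation: the part of an image that is extremal in
  direction \<^term>\<open>\<theta>\<close> comes from direction \<^term>\<open>\<theta> - \<alpha>\<close>. This is the source of the circle
  map.\<close>

lemma inner_similitude:
  "similitude q \<alpha> c z \<bullet> cis \<theta> = q * ((z - c) \<bullet> cis (\<theta> - \<alpha>)) + c \<bullet> cis \<theta>"
  by (simp add: similitude_def inner_complex_def cos_diff sin_diff Re_exp Im_exp algebra_simps)

lemma dist_similitude: "dist (similitude q \<alpha> c z) (similitude q \<alpha> c z') = \<bar>q\<bar> * dist z z'"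
proof -
  have "similitude q \<alpha> c z - similitude q \<alpha> c z' = of_real q * exp (\<i> * of_real \<alpha>) * (z - z')"
    by (simp add: similitude_def algebra_simps)
  then show ?thesis by (simp add: dist_norm norm_mult)
qed

lemma continuous_on_similitude: "continuous_on S (similitude q \<alpha> c)"
  unfolding similitude_def by (intro continuous_intros)

lemma convex_similitude_image:
  assumes "convex S"
  shows "convex (similitude q \<alpha> c ` S)"
proof -
  let ?a = "of_real q * exp (\<i> * of_real \<alpha>)"
  have "similitude q \<alpha> c ` S = (\<lambda>x. (c - ?a * c) + x) ` ((*) ?a ` S)"
    by (auto simp: similitude_def image_image algebra_simps)
  moreover have "convex ((*) ?a ` S)"
    by (intro convex_linear_image assms bounded_linear.linear bounded_linear_mult_right)
  ultimately show ?thesis using convex_translation by metis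
qed

lemma continuous_on_foldr:
  fixes \<phi> :: "'i \<Rightarrow> 'a::topological_space \<Rightarrow> 'a"
  assumes "\<And>i. continuous_on UNIV (\<phi> i)"
  shows "continuous_on A (foldr \<phi> w)"
proof (induction w)
  case (Cons i w)
  then have "continuous_on A (\<phi> i \<circ> foldr \<phi> w)"
    by (intro continuous_on_compose) (auto intro: continuous_on_subset[OF assms])
  then show ?case by simp
qed (simp add: id_def)

lemma dist_foldr_contraction:
  assumes "\<And>i x y. i \<in> I \<Longrightarrow> dist (\<phi> i x) (\<phi> i y) \<le> r * dist x y" "set w \<subseteq> I" "0 \<le> r"
  shows "dist (foldr \<phi> w x) (foldr \<phi> w y) \<le> r ^ length w * dist x y"
  using assms(2)
proof (induction w)
  case (Cons i w)
  have "dist (\<phi> i (foldr \<phi> w x)) (\<phi> i (foldr \<phi> w y)) \<le> r * dist (foldr \<phi> w x) (foldr \<phi> w y)"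
    using Cons.prems by (intro assms(1)) auto
  also have "\<dots> \<le> r * (r ^ length w * dist x y)"
    using Cons assms(3) by (intro mult_left_mono) auto
  finally show ?case by simp
qed auto

lemma invariant_set_foldr_subset:
  assumes "invariant_set I \<phi> K" "set w \<subseteq> I"
  shows "foldr \<phi> w ` K \<subseteq> K"
  using assms(2)
proof (induction w)
  case (Cons i w)
  then have "foldr \<phi> (i # w) ` K \<subseteq> \<phi> i ` K" by force
  also have "\<dots> \<subseteq> K" using assms(1) Cons.prems unfolding invariant_set_def by auto
  finally show ?case .
qed auto

lemma invariant_set_obtain_word:
  assumes "invariant_set I \<phi> K" "x \<in> K"
  obtains w y where "length w = m" "set w \<subseteq> I" "y \<in> K" "x = foldr \<phi> w y"
proof -
  have "\<exists>w y. length w = m \<and> set w \<subseteq> I \<and> y \<in> K \<and> x = foldr \<phi> w y"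
    using assms(2)
  proof (induction m arbitrary: x)
    case (Suc m)
    then obtain i z where i: "i \<in> I" "z \<in> K" "x = \<phi> i z"
      using assms(1) unfolding invariant_set_def by blast
    from Suc.IH[OF i(2)] obtain w y where "length w = m" "set w \<subseteq> I" "y \<in> K" "z = foldr \<phi> w y"
      by blast
    then show ?case using i by (intro exI[of _ "i # w"] exI[of _ y]) auto
  qed auto
  then show thesis using that by blast
qed

text \<open>Every point of \<^term>\<open>K\<close> is an image under arbitrarily long compositions of
  maps. These send any chosen element of \<^term>\<open>S\<close> to elements of \<^term>\<open>S\<close> that come arbitrarily
  close to that point.\<close>

lemma invariant_set_subset_closure:
  fixes \<phi> :: "'i \<Rightarrow> 'a::metric_space \<Rightarrow> 'a"
  assumes inv: "invariant_set I \<phi> K"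
    and contr: "\<And>i x y. i \<in> I \<Longrightarrow> dist (\<phi> i x) (\<phi> i y) \<le> r * dist x y" and r: "0 \<le> r" "r < 1"
    and S: "S \<noteq> {}" "(\<Union>i\<in>I. \<phi> i ` S) \<subseteq> S"
  shows "K \<subseteq> closure S"
proof
  fix x assume x: "x \<in> K"
  obtain z where z: "z \<in> S" using S(1) by blast
  have "bounded K" using inv by (simp add: invariant_set_def compact_imp_bounded)
  then obtain B where B: "\<And>y. y \<in> K \<Longrightarrow> dist z y \<le> B" using bounded_any_center by metis
  have orbit: "foldr \<phi> w z \<in> S" if "set w \<subseteq> I" for w
    using that S(2) z by (induction w) auto
  show "x \<in> closure S"
    unfolding closure_approachable
  proof (intro allI impI)
    fix e :: real assume e: "e > 0"
    have "(\<lambda>m. r ^ m * B) \<longlonglongrightarrow> 0"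
      using r by (intro tendsto_mult_left_zero LIMSEQ_realpow_zero) auto
    then have "\<forall>\<^sub>F m in sequentially. r ^ m * B < e" using e by (rule order_tendstoD)
    then obtain m where m: "r ^ m * B < e" using eventually_happens by force
    obtain w y where w: "length w = m" "set w \<subseteq> I" "y \<in> K" "x = foldr \<phi> w y"
      using invariant_set_obtain_word[OF inv x] by metis
    have "dist (foldr \<phi> w z) x \<le> r ^ m * dist z y"
      using dist_foldr_contraction[of I \<phi> r w z y, OF contr w(2) r(1)] w by simp
    also have "\<dots> \<le> r ^ m * B" using B w(3) r by (intro mult_left_mono) auto
    finally show "\<exists>y\<in>S. dist y x < e" using m orbit[OF w(2)] by (intro bexI[of _ "foldr \<phi> w z"]) auto
  qed
qed

section \<open>Hausdorff dimension zero from economical covers\<close>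

lemma power_powr: "0 < x \<Longrightarrow> (x ^ n) powr s = (x powr s) ^ n" for x :: real
  by (simp add: powr_powr mult.commute flip: powr_realpow)

lemma hausdorff_premeasure_le_finite_cover:
  fixes G :: "'b \<Rightarrow> 'a::metric_space set"
  assumes s: "s > 0" and V: "finite V" and cov: "A \<subseteq> (\<Union>w\<in>V. G w)"
    and G: "\<And>w. w \<in> V \<Longrightarrow> bounded (G w) \<and> diameter (G w) \<le> d" and d: "0 \<le> d" "d \<le> \<delta>"
  shows "hausdorff_premeasure s \<delta> A \<le> ennreal (card V * d powr s)"
proof -
  obtain f where f: "bij_betw f {..<card V} V"
    using ex_bij_betw_nat_finite[OF V] by (auto simp: atLeast0LessThan)
  define U where "U i = (if i < card V then G (f i) else {})" for i
  have fV: "f i \<in> V" if "i < card V" for i using f that by (auto simp: bij_betw_def)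
  have "hausdorff_premeasure s \<delta> A \<le> (\<Sum>i. diam_power s (U i))"
    unfolding hausdorff_premeasure_def
  proof (intro INF_lower CollectI conjI allI)
    show "A \<subseteq> (\<Union>i. U i)"
    proof
      fix x assume "x \<in> A"
      then obtain w where w: "w \<in> V" "x \<in> G w" using cov by blast
      then obtain i where "i < card V" "f i = w"
        using bij_betw_imp_surj_on[OF f] by (metis imageE lessThan_iff)
      then show "x \<in> (\<Union>i. U i)" using w by (auto simp: U_def)
    qed
    show "bounded (U i)" "diameter (U i) \<le> \<delta>" for i
      using G[OF fV, of i] d by (auto simp: U_def)
  qed
  also have "\<dots> = (\<Sum>i<card V. diam_power s (U i))"
    by (rule suminf_finite) (auto simp: U_def diam_power_def)
  also have "\<dots> \<le> (\<Sum>i<card V. ennreal (d powr s))"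
  proof (intro sum_mono)
    fix i assume "i \<in> {..<card V}"
    then have "bounded (U i)" "diameter (U i) \<le> d" using G[OF fV, of i] by (auto simp: U_def)
    then show "diam_power s (U i) \<le> ennreal (d powr s)"
      using s d by (auto simp: diam_power_def diameter_ge_0 intro!: ennreal_leI powr_mono2)
  qed
  also have "\<dots> = ennreal (card V * d powr s)"
    by (simp add: ennreal_mult flip: ennreal_of_nat_eq_real_of_nat)
  finally show ?thesis .
qed

lemma hausdorff_dim_zeroI:
  assumes "\<And>s. s > 0 \<Longrightarrow> hausdorff_measure s A = 0"
  shows "hausdorff_dim A = 0"
proof -
  have "hausdorff_dim A \<le> 0"
  proof (rule ennreal_le_epsilon)
    fix e :: real
    assume "0 < e"
    then show "hausdorff_dim A \<le> 0 + ennreal e"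
      unfolding hausdorff_dim_def using assms by (intro INF_lower2[of e]) auto
  qed
  then show ?thesis by simp
qed

text \<open>The \<^term>\<open>k\<close>th cover contributes at most \<^term>\<open>M * 3 ^ k * (r ^ (k * N) * D) powr s\<close>, a
  geometric sequence of ratio \<^term>\<open>3 * (r ^ N) powr s\<close>. The factor 3
  is the branching factor of \<open>itinerary_growth\<close>.\<close>

lemma hausdorff_measure_zero_of_exponential_covers:
  assumes s: "s > 0" and r: "0 < r" "r < 1" and D: "0 \<le> D" and N: "3 * (r ^ N) powr s < 1" "N > 0"
    and V: "\<And>k. finite (V k)" "\<And>k. card (V k) \<le> M * 3 ^ k" "\<And>k. A \<subseteq> (\<Union>w\<in>V k. G w)"
    and G: "\<And>k w. w \<in> V k \<Longrightarrow> bounded (G w) \<and> diameter (G w) \<le> r ^ (k * N) * D"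
  shows "hausdorff_measure s A = 0"
proof -
  have "hausdorff_premeasure s \<delta> A = 0" if \<delta>: "\<delta> > 0" for \<delta>
  proof -
    have rk: "r ^ (k * N) = (r ^ N) ^ k" for k by (metis power_mult mult.commute)
    have "(\<lambda>k. (r ^ N) ^ k * D) \<longlonglongrightarrow> 0"
      using r N by (intro tendsto_mult_left_zero LIMSEQ_realpow_zero) (auto simp: power_less_one_iff)
    then have small: "\<forall>\<^sub>F k in sequentially. r ^ (k * N) * D < \<delta>"
      using order_tendstoD(2)[OF _ \<delta>] by (simp add: rk)
    have "(\<lambda>k. (3 * (r ^ N) powr s) ^ k * (M * D powr s)) \<longlonglongrightarrow> 0"
      using N by (intro tendsto_mult_left_zero LIMSEQ_realpow_zero) auto
    then have lim: "(\<lambda>k. ennreal ((3 * (r ^ N) powr s) ^ k * (M * D powr s))) \<longlonglongrightarrow> 0"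
      using tendsto_ennrealI by fastforce
    have "\<forall>\<^sub>F k in sequentially.
        hausdorff_premeasure s \<delta> A \<le> ennreal ((3 * (r ^ N) powr s) ^ k * (M * D powr s))"
      using small
    proof eventually_elim
      case (elim k)
      have "hausdorff_premeasure s \<delta> A \<le> ennreal (card (V k) * (r ^ (k * N) * D) powr s)"
        using s V G D r elim by (intro hausdorff_premeasure_le_finite_cover[where G = G]) auto
      also have "\<dots> \<le> ennreal (real (M * 3 ^ k) * (r ^ (k * N) * D) powr s)"
        using V(2)[of k] by (intro ennreal_leI mult_right_mono) (auto simp del: of_nat_mult)
      also have "(r ^ (k * N) * D) powr s = ((r ^ N) powr s) ^ k * D powr s"
        using r D by (simp add: rk powr_mult power_powr)
      also have "real (M * 3 ^ k) * (((r ^ N) powr s) ^ k * D powr s)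
          = (3 * (r ^ N) powr s) ^ k * (M * D powr s)"
        by (simp add: power_mult_distrib)
      finally show ?case .
    qed
    then have "hausdorff_premeasure s \<delta> A \<le> 0"
      using tendsto_lowerbound[OF lim] by simp
    then show ?thesis by simp
  qed
  then show ?thesis by (simp add: hausdorff_measure_def)
qed

section \<open>The coding of directions and the dimension of the vertex set\<close>

text \<open>A maximal point of \<^term>\<open>K\<close> in direction \<^term>\<open>\<theta>\<close> may be taken in the piece of index
  \<^term>\<open>c \<theta>\<close>; pulled back by the similitude it is to be maximal in the direction
  \<^term>\<open>\<theta> - \<alpha> (c \<theta>)\<close>, where the induction hypothesis provides a point in a piece of the next
  level.\<close>

lemma itinerary_piece_dominates:
  assumes \<phi>: "\<And>i. i \<in> I \<Longrightarrow> \<phi> i = similitude (q i) (\<alpha> i) (z0 i)"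
    and q: "\<And>i. i \<in> I \<Longrightarrow> 0 < q i"
    and c: "\<And>\<theta>. c \<theta> \<in> I" "\<And>\<theta>. dominates (cis \<theta>) (\<phi> (c \<theta>) ` K) K"
  shows "dominates (cis \<theta>) (foldr \<phi> (itinerary c \<alpha> m \<theta>) ` K) K"
proof (induction m arbitrary: \<theta>)
  case 0
  show ?case by (auto simp: dominates_def)
next
  case (Suc m)
  let ?i = "c \<theta>"
  show ?case
    unfolding dominates_def
  proof
    fix y assume "y \<in> K"
    then obtain z where z: "z \<in> K" "y \<bullet> cis \<theta> \<le> \<phi> ?i z \<bullet> cis \<theta>"
      using c(2) unfolding dominates_def by blast
    obtain x where x: "x \<in> foldr \<phi> (itinerary c \<alpha> m (\<theta> - \<alpha> ?i)) ` K"
        "z \<bullet> cis (\<theta> - \<alpha> ?i) \<le> x \<bullet> cis (\<theta> - \<alpha> ?i)"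
      using Suc z(1) unfolding dominates_def by blast
    have "\<phi> ?i z \<bullet> cis \<theta> \<le> \<phi> ?i x \<bullet> cis \<theta>"
      using x(2) q[OF c(1)[of \<theta>]] by (simp add: \<phi>[OF c(1)] inner_similitude inner_diff_left)
    moreover have "\<phi> ?i x \<in> foldr \<phi> (itinerary c \<alpha> (Suc m) \<theta>) ` K" using x(1) by auto
    ultimately show "\<exists>x\<in>foldr \<phi> (itinerary c \<alpha> (Suc m) \<theta>) ` K. y \<bullet> cis \<theta> \<le> x \<bullet> cis \<theta>"
      using z(2) by (meson order_trans)
  qed
qed

lemma exists_dominating_piece:
  fixes K :: "'a::real_inner set"
  assumes "invariant_set I \<phi> K"
  shows "\<exists>i\<in>I. \<forall>j\<in>I. dominates v (\<phi> i ` K) (\<phi> j ` K)"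
proof -
  have "continuous_on K (\<lambda>x. x \<bullet> v)" by (intro continuous_intros)
  then obtain x where x: "x \<in> K" "\<And>y. y \<in> K \<Longrightarrow> y \<bullet> v \<le> x \<bullet> v"
    using assms continuous_attains_sup[of K "\<lambda>x. x \<bullet> v"] unfolding invariant_set_def by blast
  then obtain i where i: "i \<in> I" "x \<in> \<phi> i ` K" using assms unfolding invariant_set_def by blast
  have "\<phi> j ` K \<subseteq> K" if "j \<in> I" for j using assms that unfolding invariant_set_def by blast
  then show ?thesis using i x unfolding dominates_def by blast
qed

text \<open>The separation is weak: pieces may touch, and in a degenerate case both may lie on the separating
  line. The images of the open set are disjoint and have nonempty interior even if
  \<^term>\<open>K\<close> itself lies on a line, so this case is not special.\<close>

lemma open_convex_set_condition_pieces_separated: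
  assumes inv: "invariant_set I \<phi> K"
    and \<phi>: "\<And>i. i \<in> I \<Longrightarrow> \<phi> i = similitude (q i) (\<alpha> i) (z0 i)"
    and r: "0 \<le> r" "r < 1" "\<And>i. i \<in> I \<Longrightarrow> 0 < q i \<and> q i \<le> r"
    and ocsc: "open_convex_set_condition I \<phi>" and ij: "i \<in> I" "j \<in> I" "i \<noteq> j"
  obtains a where "a \<noteq> 0" "\<And>x y. x \<in> \<phi> i ` K \<Longrightarrow> y \<in> \<phi> j ` K \<Longrightarrow> x \<bullet> a \<le> y \<bullet> a"
proof -
  obtain S where S: "S \<noteq> {}" "convex S" "(\<Union>i\<in>I. \<phi> i ` S) \<subseteq> S"
      and disj: "\<forall>i\<in>I. \<forall>j\<in>I. i \<noteq> j \<longrightarrow> \<phi> i ` S \<inter> \<phi> j ` S = {}"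
    using ocsc unfolding open_convex_set_condition_def by (elim exE conjE)
  have "dist (\<phi> k x) (\<phi> k y) \<le> r * dist x y" if "k \<in> I" for k x y
    using r(3)[OF that] by (simp add: \<phi>[OF that] dist_similitude mult_right_mono)
  then have KS: "K \<subseteq> closure S"
    by (rule invariant_set_subset_closure[OF inv _ r(1,2) S(1,3)])
  have piece: "\<phi> k ` K \<subseteq> closure (\<phi> k ` S)" if "k \<in> I" for k
  proof -
    have "\<phi> k ` closure S \<subseteq> closure (\<phi> k ` S)"
      by (intro image_closure_subset closure_subset closed_closure)
         (simp add: \<phi>[OF that] continuous_on_similitude)
    then show ?thesis using KS by blast
  qed
  have "convex (\<phi> i ` S)" "convex (\<phi> j ` S)"
    using ij S(2) by (auto simp: \<phi> convex_similitude_image)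
  then obtain a b where ab: "a \<noteq> 0" "\<forall>x\<in>\<phi> i ` S. a \<bullet> x \<le> b" "\<forall>x\<in>\<phi> j ` S. b \<le> a \<bullet> x"
    using separating_hyperplane_sets[of "\<phi> i ` S" "\<phi> j ` S"] S(1) disj ij by auto
  have "closure (\<phi> i ` S) \<subseteq> {x. a \<bullet> x \<le> b}"
    using ab(2) by (intro closure_minimal closed_halfspace_le) auto
  moreover have "closure (\<phi> j ` S) \<subseteq> {x. b \<le> a \<bullet> x}"
    using ab(3) by (intro closure_minimal closed_halfspace_ge) auto
  ultimately have "x \<bullet> a \<le> y \<bullet> a" if "x \<in> \<phi> i ` K" "y \<in> \<phi> j ` K" for x y
    using piece[OF ij(1)] piece[OF ij(2)] that by (force simp: inner_commute)
  then show thesis using ab(1) that by blast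
qed

text \<open>The choice operator makes the coding a function of the finitely many truth values
  of comparisons between two pieces. It is thereby piecewise constant because the comparisons are,
  and periodic because they depend on \<^term>\<open>cis \<theta>\<close> only.\<close>

lemma obtain_direction_coding:
  fixes K :: "complex set"
  assumes inv: "invariant_set I \<phi> K" and fin: "finite I"
    and sep: "\<And>i j. i \<in> I \<Longrightarrow> j \<in> I \<Longrightarrow> i \<noteq> j \<Longrightarrow>
      \<exists>a. a \<noteq> 0 \<and> (\<forall>x\<in>\<phi> i ` K. \<forall>y\<in>\<phi> j ` K. x \<bullet> a \<le> y \<bullet> a)"
  obtains c where "\<And>\<theta>. c \<theta> \<in> I" "\<And>\<theta>. dominates (cis \<theta>) (\<phi> (c \<theta>) ` K) K"
    "piecewise_const c" "\<And>\<theta>. c (\<theta> + 2 * pi) = c \<theta>"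
proof -
  define c where "c \<theta> = (SOME i. i \<in> I \<and> (\<forall>j\<in>I. dominates (cis \<theta>) (\<phi> i ` K) (\<phi> j ` K)))" for \<theta>
  have c: "c \<theta> \<in> I \<and> (\<forall>j\<in>I. dominates (cis \<theta>) (\<phi> (c \<theta>) ` K) (\<phi> j ` K))" for \<theta>
    unfolding c_def by (rule someI_ex) (use exists_dominating_piece[OF inv] in blast)
  have pc: "piecewise_const (\<lambda>\<theta>. dominates (cis \<theta>) (\<phi> i ` K) (\<phi> j ` K))"
    if ij: "i \<in> I" "j \<in> I" for i j
  proof (cases "i = j")
    case True
    then have "(\<lambda>\<theta>. dominates (cis \<theta>) (\<phi> i ` K) (\<phi> j ` K)) = (\<lambda>\<theta>. True)"
      by (auto simp: dominates_def)
    then show ?thesis by (auto simp: piecewise_const_def)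
  next
    case False
    from sep[OF ij this] obtain a
      where "a \<noteq> 0" and "\<forall>x\<in>\<phi> i ` K. \<forall>y\<in>\<phi> j ` K. x \<bullet> a \<le> y \<bullet> a" by blast
    then show ?thesis by (intro piecewise_const_dominates[of a]) auto
  qed
  have "K = (\<Union>i\<in>I. \<phi> i ` K)" using inv unfolding invariant_set_def by blast
  then have "dominates (cis \<theta>) (\<phi> (c \<theta>) ` K) K" for \<theta>
    using c[of \<theta>] unfolding dominates_def by (metis UN_E)
  moreover have "piecewise_const c"
  proof (rule piecewise_const_determined[of "I \<times> I"
          "\<lambda>(i, j) \<theta>. dominates (cis \<theta>) (\<phi> i ` K) (\<phi> j ` K)"])
    fix y z
    assume "\<And>ij. ij \<in> I \<times> I \<Longrightarrow> (case ij of (i, j) \<Rightarrow> \<lambda>\<theta>. dominates (cis \<theta>) (\<phi> i ` K) (\<phi> j ` K)) y =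
       (case ij of (i, j) \<Rightarrow> \<lambda>\<theta>. dominates (cis \<theta>) (\<phi> i ` K) (\<phi> j ` K)) z"
    then have "(i \<in> I \<and> (\<forall>j\<in>I. dominates (cis y) (\<phi> i ` K) (\<phi> j ` K))) =
        (i \<in> I \<and> (\<forall>j\<in>I. dominates (cis z) (\<phi> i ` K) (\<phi> j ` K)))" for i by fastforce
    then show "c y = c z" unfolding c_def by simp
  qed (use pc fin in auto)
  moreover have "c (\<theta> + 2 * pi) = c \<theta>" for \<theta>
  proof -
    have "cis (\<theta> + 2 * pi) = cis \<theta>" by (simp add: complex_eq_iff)
    then show ?thesis unfolding c_def by simp
  qed
  ultimately show thesis using c that by blast
qed

theorem theorem14:
  fixes n :: nat and q \<alpha> :: "nat \<Rightarrow> real" and c :: "nat \<Rightarrow> complex" and K :: "complex set"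
  defines "\<phi> \<equiv> \<lambda>i. similitude (q i) (\<alpha> i) (c i)"
  assumes "\<And>i. i \<in> {1..n} \<Longrightarrow> 0 < q i \<and> q i < 1"
    and "\<And>i. i \<in> {1..n} \<Longrightarrow> 0 \<le> \<alpha> i \<and> \<alpha> i \<le> 2 * pi"
    and "open_convex_set_condition {1..n} \<phi>"
    and "invariant_set {1..n} \<phi> K"
  shows "hausdorff_dim {x. x extreme_point_of (convex hull K)} = 0"
proof (rule hausdorff_dim_zeroI)
  fix s :: real assume s: "s > 0"
  let ?I = "{1..n}" and ?F = "{x. x extreme_point_of (convex hull K)}"
  note inv = assms(5)
  have K: "K \<noteq> {}" "compact K" using inv unfolding invariant_set_def by auto
  \<comment> \<open>The extra element keeps the maximum positive without a separate argument that the index set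
    is inhabited.\<close>
  define r where "r = Max (insert (1/2) (q ` ?I))"
  have r: "0 < r" "r < 1" "\<And>i. i \<in> ?I \<Longrightarrow> 0 < q i \<and> q i \<le> r"
    using assms(2) by (auto simp: r_def Max_gr_iff simp del: Max_insert intro!: Max_ge)
  have contr: "dist (\<phi> i x) (\<phi> i y) \<le> r * dist x y" if "i \<in> ?I" for i x y
    using r(3)[OF that] by (simp add: \<phi>_def dist_similitude mult_right_mono)

  have sep: "\<exists>a. a \<noteq> 0 \<and> (\<forall>x\<in>\<phi> i ` K. \<forall>y\<in>\<phi> j ` K. x \<bullet> a \<le> y \<bullet> a)"
    if ij: "i \<in> ?I" "j \<in> ?I" "i \<noteq> j" for i j
  proof -
    obtain a where "a \<noteq> 0" "\<And>x y. x \<in> \<phi> i ` K \<Longrightarrow> y \<in> \<phi> j ` K \<Longrightarrow> x \<bullet> a \<le> y \<bullet> a"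
      by (rule open_convex_set_condition_pieces_separated[where q = q and \<alpha> = \<alpha> and ?z0.0 = c,
            OF inv _ less_imp_le[OF r(1)] r(2,3) assms(4) ij])
         (auto simp: \<phi>_def)
    then show ?thesis by blast
  qed
  obtain code where code: "\<And>\<theta>. code \<theta> \<in> ?I" "\<And>\<theta>. dominates (cis \<theta>) (\<phi> (code \<theta>) ` K) K"
    "piecewise_const code" "\<And>\<theta>. code (\<theta> + 2 * pi) = code \<theta>"
    using obtain_direction_coding[OF inv finite_atLeastAtMost sep] by blast

  \<comment> \<open>The step length is chosen so that the contraction beats the branching factor 3.\<close>
  obtain N where N: "3 * (r ^ N) powr s < 1" "N > 0"
  proof -
    have "r powr s < 1" using r(1,2) s by (simp add: powr01_less_one)
    then obtain N where N: "(r powr s) ^ N < 1 / 3"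
      using real_arch_pow_inv[of "1 / 3" "r powr s"] by auto
    then have "N > 0" by (cases N) auto
    moreover have "3 * (r ^ N) powr s < 1" using N power_powr[OF r(1), of N s] by simp
    ultimately show thesis using that by blast
  qed
  obtain M where M: "\<And>k. finite (range (itinerary code \<alpha> (k * N)))"
    "\<And>k. card (range (itinerary code \<alpha> (k * N))) \<le> M * 3 ^ k"
    using itinerary_growth[OF code(3) _ code(4)] by auto
  have words: "set (itinerary code \<alpha> m \<theta>) \<subseteq> ?I" for m \<theta>
    using code(1) by (intro set_itinerary_subset) auto
  have cont: "continuous_on A (foldr \<phi> w)" for w A
    by (intro continuous_on_foldr) (simp add: \<phi>_def continuous_on_similitude)
  show "hausdorff_measure s ?F = 0"
  proof (rule hausdorff_measure_zero_of_exponential_covers[OF s r(1,2) _ N M])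
    show "0 \<le> diameter K" using K(2) by (intro diameter_ge_0 compact_imp_bounded)
    show "?F \<subseteq> (\<Union>w\<in>range (itinerary code \<alpha> (k * N)). foldr \<phi> w ` K)" (is "_ \<subseteq> ?X k") for k
    proof (rule extreme_points_in_dominating_subset)
      show "compact (?X k)"
        using M(1) K(2) cont by (intro compact_UN compact_continuous_image) auto
      show "?X k \<subseteq> K"
        using invariant_set_foldr_subset[OF inv words] by blast
      fix \<theta>
      have "dominates (cis \<theta>) (foldr \<phi> (itinerary code \<alpha> (k * N) \<theta>) ` K) K"
        using r(3) code(1,2)
        by (intro itinerary_piece_dominates[where I = ?I and q = q and ?z0.0 = c]) (auto simp: \<phi>_def)
      then show "dominates (cis \<theta>) (?X k) K"
        by (rule dominates_mono) auto
    qed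
    fix k w assume "w \<in> range (itinerary code \<alpha> (k * N))"
    then have w: "length w = k * N" "set w \<subseteq> ?I" using words by auto
    have "dist (foldr \<phi> w x) (foldr \<phi> w y) \<le> r ^ (k * N) * diameter K" if "x \<in> K" "y \<in> K" for x y
    proof -
      have "dist (foldr \<phi> w x) (foldr \<phi> w y) \<le> r ^ (k * N) * dist x y"
        using dist_foldr_contraction[of ?I \<phi> r w x y, OF contr w(2)] r(1) w(1) by simp
      also have "\<dots> \<le> r ^ (k * N) * diameter K"
        using that r(1) K(2) by (intro mult_left_mono diameter_bounded_bound compact_imp_bounded) auto
      finally show ?thesis .
    qed
    then have "diameter (foldr \<phi> w ` K) \<le> r ^ (k * N) * diameter K"
      using K(1) by (intro diameter_le) (auto simp: dist_norm)
    moreover have "bounded (foldr \<phi> w ` K)"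
      using K(2) cont by (intro compact_imp_bounded compact_continuous_image)
    ultimately show "bounded (foldr \<phi> w ` K) \<and> diameter (foldr \<phi> w ` K) \<le> r ^ (k * N) * diameter K"
      by blast
  qed
qed

end
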